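(* Let $p$ be a square free positive integer. Then there exist two discontinuous additive functions $A:\mathbb{Q}(\sqrt{p})\to\mathbb{R}$ and $B:\mathbb{Q}(\sqrt{p})\to\mathbb{R}$ such that the functions $A$ and $B$ fulfill the inequalities $$B(x^2)\,B(y^2)\leq A(xy)^2\leq A(x^2)\,A(y^2)$$ and $$B(x^2)\,B(y^2)\leq B(xy)^2\leq A(x^2)\,A(y^2)$$ for all $x,y\in\mathbb{Q}(\sqrt{p})$.
   Context: $\mathbb{Q}(\sqrt{p})$ denotes the subfield of $\mathbb{R}$ generated by $\sqrt{p}$, i.e. $\mathbb{Q}(\sqrt{p})=\{a+b\sqrt{p}: a,b\in\mathbb{Q}\}$, with the topology inherited from $\mathbb{R}$; discontinuous means not continuous with respect to this topology. A function $A:\mathbb{Q}(\sqrt{p})\to\mathbb{R}$ is additive if $A(x+y)=A(x)+A(y)$ for all $x,y\in\mathbb{Q}(\sqrt{p})$. $A(u)^2$ denotes $(A(u))^2$, and similarly for $B$.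
   Formalization: The case p = 1 is excluded (p > 1 is assumed), because then Q(√p) = Q, on which every additive function is linear and hence continuous, so the claim fails; A and B are moreover required to be distinct. *)

theory Defs
  imports Complex_Main "HOL-Computational_Algebra.Squarefree"
begin

definition quadratic_field :: "nat \<Rightarrow> real set" where
  "quadratic_field p = {a + b * sqrt (real p) | a b. a \<in> \<rat> \<and> b \<in> \<rat>}"

text \<open>
  A function on a subset \<open>K\<close> of the reals is represented by a function on all reals; only its
  values on \<open>K\<close> are ever referred to.
\<close>

definition additive_on :: "real set \<Rightarrow> (real \<Rightarrow> real) \<Rightarrow> bool" where
  "additive_on K f \<longleftrightarrow> (\<forall>x\<in>K. \<forall>y\<in>K. f (x + y) = f x + f y)"

end

theory Submission
  imports Defs
begin

text \<open>
  Split \<open>x = a + b \<surd>p\<close> into its rational part \<open>A x = a\<close> and its irrational part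
  \<open>B x = b \<surd>p\<close>. With \<open>x'\<close> the conjugate of \<open>x\<close>, these are \<open>(x + x') / 2\<close> and \<open>(x - x') / 2\<close>.
  Since conjugation is multiplicative, \<open>A (x y)\<close> is half the polarization of the positive definite
  form \<open>x\<^sup>2 + x'\<^sup>2\<close>, and \<open>B (x y)\<close> is half that of the form \<open>x\<^sup>2 - x'\<^sup>2\<close>, which has signature
  \<open>(1, 1)\<close>. So Cauchy--Schwarz bounds \<open>A (x y)\<^sup>2\<close> from above, and the reversed Cauchy--Schwarz
  inequality bounds \<open>B (x y)\<^sup>2\<close> from below. Replacing \<open>x'\<close> by \<open>-x'\<close>
  keeps both forms and exchanges \<open>A (x y)\<close> with \<open>B (x y)\<close>, which gives the mixed inequalities. In terms of the parts of \<open>x\<close> and \<open>y\<close>, each of the four differences is a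
  square.

  Both functions are discontinuous at \<open>\<surd>p\<close>: along rationals tending to \<open>\<surd>p\<close>, \<open>A\<close> is the identity
  and \<open>B\<close> vanishes, while \<open>A (\<surd>p) = 0\<close> and \<open>B (\<surd>p) = \<surd>p\<close>.
\<close>

text \<open>
  A rational square root of an integer is itself an integer, so \<open>p\<close> would be a perfect square; the
  only squarefree one is \<open>1\<close>.
\<close>

lemma sqrt_squarefree_irrational:
  fixes p :: nat
  assumes "squarefree p" and "p > 1"
  shows "sqrt (real p) \<notin> \<rat>"
proof
  assume "sqrt (real p) \<in> \<rat>"
  then obtain m n :: nat where "n \<noteq> 0" and mn: "\<bar>sqrt (real p)\<bar> = real m / real n"
    and "coprime m n"
    by (rule Rats_abs_nat_div_natE)
  from \<open>n \<noteq> 0\<close> mn have "real m = sqrt (real p) * real n"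
    by (simp add: field_simps)
  then have "real (m\<^sup>2) = real (p * n\<^sup>2)"
    by (simp add: power_mult_distrib)
  then have eq: "m\<^sup>2 = p * n\<^sup>2"
    by (simp only: of_nat_eq_iff)
  then have "n\<^sup>2 dvd m\<^sup>2"
    by simp
  then have "n dvd m"
    by simp
  with \<open>coprime m n\<close> have "n = 1"
    by (metis coprime_common_divisor_nat dvd_refl nat_dvd_1_iff_1)
  with eq have "p = m\<^sup>2"
    by simp
  with \<open>squarefree p\<close> have "m = 1"
    by (metis dvd_refl nat_dvd_1_iff_1 squarefreeD)
  with \<open>p = m\<^sup>2\<close> \<open>p > 1\<close> show False
    by simp
qed

lemma rational_coordinates_unique:
  fixes a b c d s :: real
  assumes "s \<notin> \<rat>" and "a \<in> \<rat>" "b \<in> \<rat>" "c \<in> \<rat>" "d \<in> \<rat>"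
    and eq: "a + b * s = c + d * s"
  shows "a = c"
proof (rule ccontr)
  assume "a \<noteq> c"
  from eq have lin: "(b - d) * s = c - a"
    by (simp add: algebra_simps)
  with \<open>a \<noteq> c\<close> have "b - d \<noteq> 0"
    by auto
  with lin have "s = (c - a) / (b - d)"
    by (simp add: field_simps)
  then have "s \<in> \<rat>"
    using assms by simp
  with \<open>s \<notin> \<rat>\<close> show False ..
qed

definition rational_part :: "nat \<Rightarrow> real \<Rightarrow> real" where
  "rational_part p x = (THE a. a \<in> \<rat> \<and> (\<exists>b\<in>\<rat>. x = a + b * sqrt (real p)))"

lemma rational_part_eq:
  assumes "sqrt (real p) \<notin> \<rat>" and "a \<in> \<rat>" "b \<in> \<rat>"
  shows "rational_part p (a + b * sqrt (real p)) = a"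
  unfolding rational_part_def
proof (rule the_equality)
  show "a \<in> \<rat> \<and> (\<exists>b'\<in>\<rat>. a + b * sqrt (real p) = a + b' * sqrt (real p))"
    using assms by blast
next
  fix c assume "c \<in> \<rat> \<and> (\<exists>d\<in>\<rat>. a + b * sqrt (real p) = c + d * sqrt (real p))"
  then show "c = a"
    using rational_coordinates_unique[OF assms(1-3)] by blast
qed

text \<open>
  Discontinuity will come from the density of the rationals: a continuous function is determined by
  its rational values, so it cannot equal one continuous function there and another elsewhere.
\<close>

lemma continuous_on_eq_if_eq_on_Rats:
  fixes f g :: "real \<Rightarrow> real"
  assumes "continuous_on K f" "continuous_on K g" and "\<rat> \<subseteq> K" "x \<in> K"
    and eq: "\<And>q. q \<in> \<rat> \<Longrightarrow> f q = g q"
  shows "f x = g x"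
proof -
  have "\<exists>q\<in>\<rat>. x < q \<and> q < x + inverse (real (Suc n))" for n
    by (rule Rats_dense_in_real) simp
  then obtain r where r: "\<And>n. r n \<in> \<rat>" "\<And>n. x < r n"
    "\<And>n. r n < x + inverse (real (Suc n))"
    by metis
  have lim: "r \<longlonglongrightarrow> x"
  proof (rule tendsto_sandwich[OF _ _ tendsto_const LIMSEQ_inverse_real_of_nat_add])
    show "\<forall>\<^sub>F n in sequentially. x \<le> r n"
      by (intro always_eventually allI less_imp_le r(2))
    show "\<forall>\<^sub>F n in sequentially. r n \<le> x + inverse (real (Suc n))"
      by (intro always_eventually allI less_imp_le r(3))
  qed
  have r_K: "\<forall>\<^sub>F n in sequentially. r n \<in> K"
    using r(1) \<open>\<rat> \<subseteq> K\<close> by (intro always_eventually allI) blast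
  have "(\<lambda>n. f (r n)) \<longlonglongrightarrow> f x"
    by (rule continuous_on_tendsto_compose[OF assms(1) lim \<open>x \<in> K\<close> r_K])
  moreover have "(\<lambda>n. g (r n)) \<longlonglongrightarrow> g x"
    by (rule continuous_on_tendsto_compose[OF assms(2) lim \<open>x \<in> K\<close> r_K])
  moreover have "(\<lambda>n. f (r n)) = (\<lambda>n. g (r n))"
    by (intro ext eq r(1))
  ultimately show ?thesis
    using LIMSEQ_unique by metis
qed

text \<open>
  Here \<open>a, v\<close> and \<open>c, w\<close> stand for the rational and irrational parts of two elements, so that their
  product has rational part \<open>a c + v w\<close> and irrational part \<open>a w + v c\<close>.
\<close>

lemma part_inequalities:
  fixes a v c w :: real
  shows "(2 * a * v) * (2 * c * w) \<le> (a * c + v * w)\<^sup>2"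
    and "(a * c + v * w)\<^sup>2 \<le> (a\<^sup>2 + v\<^sup>2) * (c\<^sup>2 + w\<^sup>2)"
    and "(2 * a * v) * (2 * c * w) \<le> (a * w + v * c)\<^sup>2"
    and "(a * w + v * c)\<^sup>2 \<le> (a\<^sup>2 + v\<^sup>2) * (c\<^sup>2 + w\<^sup>2)"
proof -
  have "(a * c + v * w)\<^sup>2 - (2 * a * v) * (2 * c * w) = (a * c - v * w)\<^sup>2"
    by (simp add: power2_eq_square algebra_simps)
  then show "(2 * a * v) * (2 * c * w) \<le> (a * c + v * w)\<^sup>2"
    by (metis diff_ge_0_iff_ge zero_le_power2)
  have "(a\<^sup>2 + v\<^sup>2) * (c\<^sup>2 + w\<^sup>2) - (a * c + v * w)\<^sup>2 = (a * w - v * c)\<^sup>2"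
    by (simp add: power2_eq_square algebra_simps)
  then show "(a * c + v * w)\<^sup>2 \<le> (a\<^sup>2 + v\<^sup>2) * (c\<^sup>2 + w\<^sup>2)"
    by (metis diff_ge_0_iff_ge zero_le_power2)
  have "(a * w + v * c)\<^sup>2 - (2 * a * v) * (2 * c * w) = (a * w - v * c)\<^sup>2"
    by (simp add: power2_eq_square algebra_simps)
  then show "(2 * a * v) * (2 * c * w) \<le> (a * w + v * c)\<^sup>2"
    by (metis diff_ge_0_iff_ge zero_le_power2)
  have "(a\<^sup>2 + v\<^sup>2) * (c\<^sup>2 + w\<^sup>2) - (a * w + v * c)\<^sup>2 = (a * c - v * w)\<^sup>2"
    by (simp add: power2_eq_square algebra_simps)
  then show "(a * w + v * c)\<^sup>2 \<le> (a\<^sup>2 + v\<^sup>2) * (c\<^sup>2 + w\<^sup>2)"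
    by (metis diff_ge_0_iff_ge zero_le_power2)
qed

theorem theorem4p7:
  fixes p :: nat
  assumes "squarefree p" and "p > 1"
  shows "\<exists>A B :: real \<Rightarrow> real.
    additive_on (quadratic_field p) A \<and> \<not> continuous_on (quadratic_field p) A \<and>
    additive_on (quadratic_field p) B \<and> \<not> continuous_on (quadratic_field p) B \<and>
    (\<exists>x\<in>quadratic_field p. A x \<noteq> B x) \<and>
    (\<forall>x\<in>quadratic_field p. \<forall>y\<in>quadratic_field p.
      B (x\<^sup>2) * B (y\<^sup>2) \<le> (A (x * y))\<^sup>2 \<and> (A (x * y))\<^sup>2 \<le> A (x\<^sup>2) * A (y\<^sup>2) \<and>
      B (x\<^sup>2) * B (y\<^sup>2) \<le> (B (x * y))\<^sup>2 \<and> (B (x * y))\<^sup>2 \<le> A (x\<^sup>2) * A (y\<^sup>2))"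
proof -
  define s where "s = sqrt (real p)"
  define K where "K = quadratic_field p"
  define A where "A = rational_part p"
  define B where "B = (\<lambda>x. x - A x)"
  have irr: "s \<notin> \<rat>"
    unfolding s_def using assms by (rule sqrt_squarefree_irrational)
  then have "s \<noteq> 0"
    by auto
  have ss: "s * s = real p"
    by (simp add: s_def)
  have K_iff: "x \<in> K \<longleftrightarrow> (\<exists>a\<in>\<rat>. \<exists>b\<in>\<rat>. x = a + b * s)" for x
    by (auto simp: K_def quadratic_field_def s_def)
  have A_eq: "A (a + b * s) = a" if "a \<in> \<rat>" "b \<in> \<rat>" for a b
    using rational_part_eq irr that unfolding A_def s_def by blast
  have B_eq: "B (a + b * s) = b * s" if "a \<in> \<rat>" "b \<in> \<rat>" for a b
    using A_eq that by (simp add: B_def)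

  have A_Rats: "A q = q" and B_Rats: "B q = 0" if "q \<in> \<rat>" for q
    using A_eq[of q 0] B_eq[of q 0] that by simp_all
  have A_s: "A s = 0" and B_s: "B s = s"
    using A_eq[of 0 1] B_eq[of 0 1] by simp_all
  have Rats_K: "\<rat> \<subseteq> K" and s_K: "s \<in> K"
  proof -
    show "\<rat> \<subseteq> K"
    proof
      fix q :: real assume "q \<in> \<rat>"
      moreover have "q = q + 0 * s" by simp
      ultimately show "q \<in> K"
        unfolding K_iff using Rats_0 by blast
    qed
    have "s = 0 + 1 * s" by simp
    then show "s \<in> K"
      unfolding K_iff using Rats_0 Rats_1 by blast
  qed

  have "\<not> continuous_on K A"
  proof
    assume "continuous_on K A"
    then have "A s = s"
      using continuous_on_eq_if_eq_on_Rats[of K A "\<lambda>x. x"] Rats_K s_K A_Rats by simp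
    with A_s \<open>s \<noteq> 0\<close> show False by simp
  qed
  moreover have "\<not> continuous_on K B"
  proof
    assume "continuous_on K B"
    then have "B s = 0"
      using continuous_on_eq_if_eq_on_Rats[of K B "\<lambda>x. 0"] Rats_K s_K B_Rats by simp
    with B_s \<open>s \<noteq> 0\<close> show False by simp
  qed
  moreover have add_A: "additive_on K A"
    unfolding additive_on_def
  proof (intro ballI)
    fix x y assume "x \<in> K" "y \<in> K"
    then obtain a b c d where abcd: "a \<in> \<rat>" "b \<in> \<rat>" "c \<in> \<rat>" "d \<in> \<rat>"
      and x: "x = a + b * s" and y: "y = c + d * s"
      unfolding K_iff by blast
    have "x + y = (a + c) + (b + d) * s"
      by (simp add: x y algebra_simps)
    moreover have "A ((a + c) + (b + d) * s) = a + c"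
      using abcd by (intro A_eq Rats_add)
    moreover have "A x = a" "A y = c"
      unfolding x y using abcd by (auto intro: A_eq)
    ultimately show "A (x + y) = A x + A y"
      by simp
  qed
  moreover have "additive_on K B"
    using add_A by (simp add: additive_on_def B_def)
  moreover have "\<exists>x\<in>K. A x \<noteq> B x"
    using s_K A_s B_s \<open>s \<noteq> 0\<close> by force
  moreover have "B (x\<^sup>2) * B (y\<^sup>2) \<le> (A (x * y))\<^sup>2 \<and> (A (x * y))\<^sup>2 \<le> A (x\<^sup>2) * A (y\<^sup>2) \<and>
      B (x\<^sup>2) * B (y\<^sup>2) \<le> (B (x * y))\<^sup>2 \<and> (B (x * y))\<^sup>2 \<le> A (x\<^sup>2) * A (y\<^sup>2)"
    if "x \<in> K" "y \<in> K" for x y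
  proof -
    have parts: "A (u * z) = A u * A z + B u * B z" "B (u * z) = A u * B z + B u * A z"
      if uz: "u \<in> K" "z \<in> K" for u z
    proof -
      from uz obtain a b c d where abcd: "a \<in> \<rat>" "b \<in> \<rat>" "c \<in> \<rat>" "d \<in> \<rat>"
        and u: "u = a + b * s" and z: "z = c + d * s"
        unfolding K_iff by blast
      define e f where "e = a * c + real p * b * d" and "f = a * d + b * c"
      have uz_eq: "u * z = e + f * s"
        by (simp add: u z e_def f_def ss[symmetric] algebra_simps)
      have ef: "e \<in> \<rat>" "f \<in> \<rat>"
        using abcd by (simp_all add: e_def f_def)
      have of_u: "A u = a" "B u = b * s" and of_z: "A z = c" "B z = d * s"
        unfolding u z using A_eq B_eq abcd by blast+
      have "A (u * z) = e"
        unfolding uz_eq using ef by (rule A_eq)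
      then show "A (u * z) = A u * A z + B u * B z"
        by (simp add: of_u of_z e_def ss[symmetric] algebra_simps)
      have "B (u * z) = f * s"
        unfolding uz_eq using ef by (rule B_eq)
      then show "B (u * z) = A u * B z + B u * A z"
        by (simp add: of_u of_z f_def algebra_simps)
    qed
    have A_sq: "A (u\<^sup>2) = (A u)\<^sup>2 + (B u)\<^sup>2" and B_sq: "B (u\<^sup>2) = 2 * A u * B u" if "u \<in> K" for u
      using parts[OF that that] by (simp_all add: power2_eq_square)
    show ?thesis
      unfolding A_sq[OF \<open>x \<in> K\<close>] A_sq[OF \<open>y \<in> K\<close>] B_sq[OF \<open>x \<in> K\<close>] B_sq[OF \<open>y \<in> K\<close>]
        parts[OF that]
      by (intro conjI part_inequalities)
  qed
  ultimately show ?thesis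
    unfolding K_def by blast
qed

end
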